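(* A countable directed forest is unary FA-presentable if and only if (1) it has only finitely many infinite connected components, each of which is a unary FA-presentable directed tree, and (2) there is a bound on the number of vertices of its finite connected components.
   Context: A directed forest is a directed graph obtained from a forest (an acyclic undirected graph) by assigning a direction to each edge; its connected components (components of the underlying undirected graph) are directed trees. A structure $(X,\eta)$ is unary FA-presentable if there exist a regular language $L\subseteq a^*$ and a surjection $\phi:L\to X$ such that $\{(u,v)\in L^2:u\phi=v\phi\}$ and $\{(u,v)\in L^2:(u\phi,v\phi)\in\eta\}$ are regular relations (the words $\mathrm{conv}(u,v)$ over $\{a,\$\}^2$, reading $u,v$ in parallel with the shorter padded by $\$$, form regular languages). *)

theory Defs
  imports Main "HOL-Library.Countable_Set"
begin

section \<open>Regular languages (via deterministic finite automata)\<close>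

text \<open>A language over an alphabet 'a is regular iff it is accepted by a DFA with
finitely many states; states are 0..<n, start state 0.\<close>

definition regular_lang :: "'a list set \<Rightarrow> bool" where
  "regular_lang L \<longleftrightarrow>
     (\<exists>(n::nat) (\<delta>::nat \<Rightarrow> 'a \<Rightarrow> nat) (F::nat set).
        0 < n \<and> (\<forall>q<n. \<forall>c. \<delta> q c < n) \<and>
        L = {w. foldl \<delta> 0 w \<in> F})"

section \<open>Unary alphabet, padding and convolution\<close>

datatype letter = LetA   \<comment> \<open>the single letter a\<close>

text \<open>Padded symbols: Some c is the letter c, None is the padding symbol \$.\<close>

definition conv :: "'a list \<Rightarrow> 'a list \<Rightarrow> ('a option \<times> 'a option) list" where
  "conv u v = map (\<lambda>i. (if i < length u then Some (u ! i) else None,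
                        if i < length v then Some (v ! i) else None))
                  [0..<max (length u) (length v)]"

definition regular_rel :: "('a list \<times> 'a list) set \<Rightarrow> bool" where
  "regular_rel R \<longleftrightarrow> regular_lang ((\<lambda>(u, v). conv u v) ` R)"

section \<open>Unary FA-presentable structures (X, eta)\<close>

definition unary_FA_presentable :: "'v set \<Rightarrow> ('v \<times> 'v) set \<Rightarrow> bool" where
  "unary_FA_presentable X \<eta> \<longleftrightarrow>
     (\<exists>(L::letter list set) (\<phi>::letter list \<Rightarrow> 'v).
        regular_lang L \<and> \<phi> ` L = X \<and>
        regular_rel {(u, v). u \<in> L \<and> v \<in> L \<and> \<phi> u = \<phi> v} \<and>
        regular_rel {(u, v). u \<in> L \<and> v \<in> L \<and> (\<phi> u, \<phi> v) \<in> \<eta>})"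

section \<open>Directed forests and trees\<close>

definition adj :: "('v \<times> 'v) set \<Rightarrow> 'v \<Rightarrow> 'v \<Rightarrow> bool" where
  "adj E x y \<longleftrightarrow> (x, y) \<in> E \<or> (y, x) \<in> E"

text \<open>A directed forest: an orientation of a forest, i.e. no loops, no pair of
opposite arcs (each undirected edge gets exactly one direction), and the underlying
undirected graph has no cycle (no closed path through \<ge> 3 distinct vertices).\<close>

definition directed_forest :: "'v set \<Rightarrow> ('v \<times> 'v) set \<Rightarrow> bool" where
  "directed_forest V E \<longleftrightarrow>
     E \<subseteq> V \<times> V \<and> (\<forall>x. (x, x) \<notin> E) \<and> (\<forall>x y. (x, y) \<in> E \<longrightarrow> (y, x) \<notin> E) \<and>
     \<not> (\<exists>cs. 3 \<le> length cs \<and> distinct cs \<and> set cs \<subseteq> V \<and>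
            (\<forall>i. Suc i < length cs \<longrightarrow> adj E (cs ! i) (cs ! Suc i)) \<and>
            adj E (last cs) (hd cs))"

text \<open>Connected component (of the underlying undirected graph) containing x.\<close>

definition component :: "'v set \<Rightarrow> ('v \<times> 'v) set \<Rightarrow> 'v \<Rightarrow> 'v set" where
  "component V E x = {y \<in> V. (x, y) \<in> (E \<union> E\<inverse>)\<^sup>*}"

definition components :: "'v set \<Rightarrow> ('v \<times> 'v) set \<Rightarrow> 'v set set" where
  "components V E = component V E ` V"

definition directed_tree :: "'v set \<Rightarrow> ('v \<times> 'v) set \<Rightarrow> bool" where
  "directed_tree V E \<longleftrightarrow> directed_forest V E \<and> V \<noteq> {} \<and>
     (\<forall>x\<in>V. \<forall>y\<in>V. (x, y) \<in> (E \<union> E\<inverse>)\<^sup>*)"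

end

theory Submission
  imports Defs
begin

text \<open>Identify \<open>a\<^sup>n\<close> with \<open>n\<close>. A binary relation on \<open>a\<^sup>*\<close> is regular iff for some \<open>p > 0\<close> it is
  invariant under adding \<open>p\<close> to both entries when both are at least \<open>p\<close>, and under adding
  \<open>p\<close> to the larger entry when the two differ by at least \<open>p\<close>.

  Given a presentation, join two numbers if they denote the same or adjacent vertices. On
  \<open>{p..}\<close> connectedness in this graph is invariant under \<open>x \<mapsto> x + p\<close>. Hence a class
  containing two numbers congruent modulo \<open>p\<close> is infinite, so that finite classes have at most
  \<open>p\<close> elements, and each infinite class is invariant under translation by \<open>p * p!\<close>. The finitely
  many numbers below \<open>p\<close> can only glue such classes together in an eventually periodic way.

  Conversely, finitely many disjoint structures are presented together by interleaving, and
  the finite components of bounded size fall into finitely many isomorphism types, each of which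
  is presented by cutting the numbers into blocks of equal length.\<close>

section \<open>Ultimately periodic sets and binary relations of natural numbers\<close>

definition periodic_set :: "nat \<Rightarrow> nat set \<Rightarrow> bool" where
  "periodic_set p S \<longleftrightarrow> (\<forall>n\<ge>p. n + p \<in> S \<longleftrightarrow> n \<in> S)"

definition periodic_rel :: "nat \<Rightarrow> (nat \<times> nat) set \<Rightarrow> bool" where
  "periodic_rel p R \<longleftrightarrow>
     (\<forall>i\<ge>p. \<forall>j\<ge>p. (i + p, j + p) \<in> R \<longleftrightarrow> (i, j) \<in> R) \<and>
     (\<forall>i j. i + p \<le> j \<longrightarrow> ((i, j + p) \<in> R \<longleftrightarrow> (i, j) \<in> R) \<and> ((j + p, i) \<in> R \<longleftrightarrow> (j, i) \<in> R))"

lemma periodic_setD: "periodic_set p S \<Longrightarrow> p \<le> n \<Longrightarrow> n + p \<in> S \<longleftrightarrow> n \<in> S"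
  by (simp add: periodic_set_def)

lemma periodic_relD:
  assumes "periodic_rel p R"
  shows "p \<le> i \<Longrightarrow> p \<le> j \<Longrightarrow> (i + p, j + p) \<in> R \<longleftrightarrow> (i, j) \<in> R"
    and "i + p \<le> j \<Longrightarrow> (i, j + p) \<in> R \<longleftrightarrow> (i, j) \<in> R"
    and "i + p \<le> j \<Longrightarrow> (j + p, i) \<in> R \<longleftrightarrow> (j, i) \<in> R"
  using assms by (simp_all add: periodic_rel_def)

lemma periodic_set_add_mult:
  assumes "periodic_set p S" "p \<le> n"
  shows "n + k * p \<in> S \<longleftrightarrow> n \<in> S"
proof (induction k)
  case (Suc k)
  then show ?case
    using periodic_setD[OF assms(1), of "n + k * p"] assms(2) by (simp add: ac_simps)
qed simp

lemma periodic_rel_add_mult: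
  assumes "periodic_rel p R"
  shows "p \<le> i \<Longrightarrow> p \<le> j \<Longrightarrow> (i + k * p, j + k * p) \<in> R \<longleftrightarrow> (i, j) \<in> R"
    and "i + p \<le> j \<Longrightarrow> (i, j + k * p) \<in> R \<longleftrightarrow> (i, j) \<in> R"
    and "i + p \<le> j \<Longrightarrow> (j + k * p, i) \<in> R \<longleftrightarrow> (j, i) \<in> R"
proof (induction k)
  case (Suc k)
  {
    case 1
    then show ?case
      using Suc periodic_relD(1)[OF assms, of "i + k * p" "j + k * p"] by (simp add: ac_simps)
  next
    case 2
    then show ?case
      using Suc periodic_relD(2)[OF assms, of i "j + k * p"] by (simp add: ac_simps)
  next
    case 3
    then show ?case
      using Suc periodic_relD(3)[OF assms, of i "j + k * p"] by (simp add: ac_simps)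
  }
qed simp_all

text \<open>Passing to a multiple raises the threshold and coarsens the period at once, so finitely
  many sets and relations acquire a common \<open>p\<close> by multiplying theirs.\<close>

lemma periodic_set_mult:
  assumes "periodic_set p S" "0 < k"
  shows "periodic_set (k * p) S"
  unfolding periodic_set_def
proof (intro allI impI)
  fix n assume "k * p \<le> n"
  moreover have "p \<le> k * p" using assms(2) by simp
  ultimately have "p \<le> n" by linarith
  then show "n + k * p \<in> S \<longleftrightarrow> n \<in> S"
    using periodic_set_add_mult[OF assms(1)] by simp
qed

lemma periodic_rel_mult:
  assumes "periodic_rel p R" "0 < k"
  shows "periodic_rel (k * p) R"
proof -
  have le: "p \<le> k * p" using assms(2) by simp
  show ?thesis
    unfolding periodic_rel_def
  proof (intro conjI allI impI)
    fix i j assume "k * p \<le> i" "k * p \<le> j"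
    then show "(i + k * p, j + k * p) \<in> R \<longleftrightarrow> (i, j) \<in> R"
      using le by (intro periodic_rel_add_mult(1)[OF assms(1)]) linarith+
  next
    fix i j assume "i + k * p \<le> j"
    then have "i + p \<le> j" using le by linarith
    then show "(i, j + k * p) \<in> R \<longleftrightarrow> (i, j) \<in> R" "(j + k * p, i) \<in> R \<longleftrightarrow> (j, i) \<in> R"
      using periodic_rel_add_mult(2,3)[OF assms(1)] by simp_all
  qed
qed

lemma periodic_rel_Un:
  "periodic_rel p R \<Longrightarrow> periodic_rel p R' \<Longrightarrow> periodic_rel p (R \<union> R')"
  by (simp add: periodic_rel_def)

lemma periodic_rel_converse: "periodic_rel p R \<Longrightarrow> periodic_rel p (R\<inverse>)"
  by (auto simp add: periodic_rel_def)

lemma periodic_rel_restrict: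
  "periodic_rel p R \<Longrightarrow> periodic_set p S \<Longrightarrow> periodic_rel p (R \<inter> S \<times> S)"
  by (auto simp add: periodic_rel_def periodic_set_def)

section \<open>Regular sets and relations of unary words\<close>

abbreviation unary :: "nat \<Rightarrow> letter list" where
  "unary n \<equiv> replicate n LetA"

lemma unary_length [simp]: "unary (length w) = w"
  by (induction w) (auto, metis letter.exhaust)

text \<open>By the pigeonhole principle two of the first \<open>n + 1\<close> iterates coincide.
  Their distance is at most \<open>n\<close>, hence divides \<open>fact n\<close>, which makes the
  period independent of \<open>f\<close> and \<open>q\<close>.\<close>

lemma funpow_eventually_periodic:
  fixes f :: "nat \<Rightarrow> nat"
  assumes f: "\<And>q. q < n \<Longrightarrow> f q < n" and q: "q < n" and i: "n \<le> i"
  shows "(f ^^ (i + fact n)) q = (f ^^ i) q"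
proof -
  have lt: "(f ^^ k) q < n" for k
    by (induction k) (use f q in auto)
  have "\<not> inj_on (\<lambda>k. (f ^^ k) q) {..n}"
  proof
    assume "inj_on (\<lambda>k. (f ^^ k) q) {..n}"
    then have "card {..n} \<le> card {..<n}"
      by (rule card_inj_on_le) (use lt in auto)
    then show False by simp
  qed
  then obtain a b where ab: "a < b" "b \<le> n" "(f ^^ a) q = (f ^^ b) q"
    unfolding inj_on_def by (metis atMost_iff linorder_neqE_nat)
  define k where "k = b - a"
  have step: "(f ^^ (j + k)) q = (f ^^ j) q" if "a \<le> j" for j
  proof -
    have "(f ^^ (j + k)) q = (f ^^ (j - a)) ((f ^^ b) q)"
      using that ab(1) by (simp add: k_def flip: funpow_add o_apply[of "f ^^ _" "f ^^ _"])
    also have "\<dots> = (f ^^ j) q"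
      using that by (simp flip: ab(3) funpow_add o_apply[of "f ^^ _" "f ^^ _"])
    finally show ?thesis .
  qed
  have steps: "(f ^^ (i + m * k)) q = (f ^^ i) q" for m
  proof (induction m)
    case (Suc m)
    then show ?case using step[of "i + m * k"] ab i by (simp add: ac_simps)
  qed simp
  have "k dvd fact n"
    using ab by (intro dvd_fact) (auto simp: k_def)
  then obtain m where "fact n = m * k" by (metis dvd_def mult.commute)
  then show ?thesis using steps[of m] by simp
qed

lemma foldl_replicate: "foldl \<delta> q (replicate k c) = ((\<lambda>q. \<delta> q c) ^^ k) q"
  by (induction k arbitrary: q) (simp_all add: funpow_swap1[of "\<lambda>q. \<delta> q c"])

text \<open>In the manner of Myhill and Nerode: the kernel of \<open>h\<close> is a right congruence
  of finite index that saturates \<open>L\<close>, so the values of \<open>h\<close> can serve as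
  the states of a DFA.\<close>

lemma regular_langI:
  fixes h :: "'a list \<Rightarrow> 's"
  assumes fin: "finite (range h)"
    and step: "\<And>u v c. h u = h v \<Longrightarrow> h (u @ [c]) = h (v @ [c])"
    and mem: "\<And>u v. h u = h v \<Longrightarrow> u \<in> L \<Longrightarrow> v \<in> L"
  shows "regular_lang L"
proof -
  obtain g0 :: "'s \<Rightarrow> nat" where g0: "bij_betw g0 (range h) {0..<card (range h)}"
    using ex_bij_betw_finite_nat[OF fin] by blast
  define n where "n = Suc (card (range h))"
  \<comment> \<open>The start state is fixed as 0 by \<open>regular_lang\<close>, so the value of
    \<open>h\<close> on the empty word gets number 0. The others are shifted up by one to keep the
    numbering injective.\<close>
  define g where "g s = (if s = h [] then 0 else Suc (g0 s))" for s
  have g_less: "g (h w) < n" for w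
    using g0 by (auto simp: g_def n_def bij_betw_def)
  have g_inj: "h u = h v" if "g (h u) = g (h v)" for u v
    using that g0 by (auto simp: g_def bij_betw_def inj_on_def split: if_splits)
  \<comment> \<open>The successor is computed on an arbitrary word reaching state \<open>q\<close>,
    which is sound by \<open>step\<close>. If \<open>q\<close> numbers no state, the chosen word is
    unspecified, but the result is still below \<open>n\<close>.\<close>
  define \<delta> where "\<delta> q c = g (h ((SOME w. g (h w) = q) @ [c]))" for q c
  have \<delta>: "\<delta> (g (h w)) c = g (h (w @ [c]))" for w c
  proof -
    have "g (h (SOME w'. g (h w') = g (h w))) = g (h w)"
      by (rule someI[where P = "\<lambda>w'. g (h w') = g (h w)"]) simp
    then have "h (SOME w'. g (h w') = g (h w)) = h w" by (rule g_inj)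
    then show ?thesis unfolding \<delta>_def using step by metis
  qed
  have run: "foldl \<delta> 0 w = g (h w)" for w
  proof (induction w rule: rev_induct)
    case Nil
    then show ?case by (simp add: g_def)
  qed (simp add: \<delta>)
  have "v \<in> L" if "g (h v) = g (h u)" "u \<in> L" for u v
    using mem[OF g_inj[OF that(1)[symmetric]] that(2)] .
  then have "L = {w. foldl \<delta> 0 w \<in> (\<lambda>w. g (h w)) ` L}"
    unfolding run by blast
  moreover have "\<forall>q<n. \<forall>c. \<delta> q c < n"
    using g_less by (simp add: \<delta>_def)
  moreover have "0 < n" by (simp add: n_def)
  ultimately show ?thesis unfolding regular_lang_def by blast
qed

text \<open>The representative of \<open>n\<close> in \<open>{..<2 * p}\<close>: numbers below
  \<open>p\<close> stay exact, all others are reduced modulo \<open>p\<close> into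
  \<open>{p..<2 * p}\<close>. It is a finite state and at the same time a number at which a periodic
  predicate can be evaluated.\<close>

definition residue_class :: "nat \<Rightarrow> nat \<Rightarrow> nat" where
  "residue_class p n = (if n < p then n else p + n mod p)"

lemma residue_class_0_iff [simp]: "0 < p \<Longrightarrow> residue_class p n = 0 \<longleftrightarrow> n = 0"
  by (simp add: residue_class_def)

lemma residue_class_less: "0 < p \<Longrightarrow> residue_class p n < 2 * p"
  using mod_less_divisor[of p n] by (simp add: residue_class_def)

lemma residue_class_Suc:
  assumes "0 < p" "residue_class p m = residue_class p n"
  shows "residue_class p (Suc m) = residue_class p (Suc n)"
proof (cases "m < p")
  case True
  then have "m = n" using assms by (simp add: residue_class_def split: if_splits)
  then show ?thesis by simp
next
  case False
  then have "\<not> n < p" "m mod p = n mod p"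
    using assms by (simp_all add: residue_class_def split: if_splits)
  then show ?thesis using False
    by (simp add: residue_class_def) (metis mod_Suc)
qed

text \<open>For \<open>n\<close> at least \<open>p\<close> the representative is also at least
  \<open>p\<close> and differs from \<open>n\<close> by a multiple of \<open>p\<close>, so the
  hypothesis applies repeatedly.\<close>

lemma residue_class_cong:
  assumes p: "0 < p" and P: "\<And>n. p \<le> n \<Longrightarrow> P (n + p) \<longleftrightarrow> P n"
  shows "P (residue_class p n) \<longleftrightarrow> P n"
proof (cases "n < p")
  case True
  then show ?thesis by (simp add: residue_class_def)
next
  case False
  have P': "P (m + k * p) \<longleftrightarrow> P m" if "p \<le> m" for m k
  proof (induction k)
    case (Suc k)
    then show ?case using P[of "m + k * p"] that by (simp add: ac_simps)
  qed simp
  have "n = p + n mod p + (n div p - 1) * p"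
  proof -
    have "1 \<le> n div p" using False p by (simp add: Suc_le_eq div_greater_zero_iff)
    then have "p + (n div p - 1) * p = n div p * p"
      by (simp add: diff_mult_distrib)
    then show ?thesis using div_mult_mod_eq[of n p] by linarith
  qed
  then show ?thesis using P'[of "p + n mod p" "n div p - 1"] False
    by (simp add: residue_class_def)
qed

text \<open>Forwards, reading a unary word iterates a single map on the states of the DFA.
  Backwards, the residue class of the length is a finite state that decides membership.\<close>

lemma regular_lang_unary_iff:
  "regular_lang (L :: letter list set) \<longleftrightarrow> (\<exists>p>0. periodic_set p {n. unary n \<in> L})"
proof
  assume "regular_lang L"
  then obtain n F and \<delta> :: "nat \<Rightarrow> letter \<Rightarrow> nat"
    where n: "0 < n" "\<forall>q<n. \<forall>c. \<delta> q c < n" and L: "L = {w. foldl \<delta> 0 w \<in> F}"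
    unfolding regular_lang_def by blast
  have "periodic_set (fact n) {k. unary k \<in> L}"
    unfolding periodic_set_def
  proof (intro allI impI)
    fix i :: nat assume "fact n \<le> i"
    then have "n \<le> i" using fact_ge_self[of n] by linarith
    then show "i + fact n \<in> {k. unary k \<in> L} \<longleftrightarrow> i \<in> {k. unary k \<in> L}"
      using funpow_eventually_periodic[of n "\<lambda>q. \<delta> q LetA" 0 i] n
      by (simp add: L foldl_replicate)
  qed
  then show "\<exists>p>0. periodic_set p {n. unary n \<in> L}"
    using fact_gt_zero by blast
next
  assume "\<exists>p>0. periodic_set p {n. unary n \<in> L}"
  then obtain p where p: "0 < p" "periodic_set p {n. unary n \<in> L}" by blast
  show "regular_lang L"
  proof (rule regular_langI[where h = "\<lambda>w. residue_class p (length w)"])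
    show "finite (range (\<lambda>w :: letter list. residue_class p (length w)))"
      by (rule finite_subset[of _ "{..<2 * p}"]) (use residue_class_less p in auto)
  next
    fix u v :: "letter list" and c
    assume "residue_class p (length u) = residue_class p (length v)"
    then show "residue_class p (length (u @ [c])) = residue_class p (length (v @ [c]))"
      using residue_class_Suc[OF p(1), of "length u" "length v"] by simp
  next
    fix u v :: "letter list"
    assume *: "residue_class p (length u) = residue_class p (length v)" and "u \<in> L"
    have "unary (residue_class p k) \<in> L \<longleftrightarrow> unary k \<in> L" for k
      using p(1) periodic_setD[OF p(2)] by (intro residue_class_cong) auto
    from this[of "length u"] this[of "length v"] show "v \<in> L"
      unfolding * unary_length using \<open>u \<in> L\<close> by blast
  qed
qed

text \<open>The infinite-state automaton reading a convolution: state \<open>Some (i, d, e)\<close> is reached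
  after exactly the word encoding the pair of lengths \<open>(i + d, i + e)\<close>, where at most one of
  \<open>d\<close>, \<open>e\<close> is nonzero.\<close>

fun conv_step :: "(nat \<times> nat \<times> nat) option \<Rightarrow> letter option \<times> letter option \<Rightarrow>
    (nat \<times> nat \<times> nat) option" where
  "conv_step (Some (i, d, e)) (Some _, Some _) =
     (if d = 0 \<and> e = 0 then Some (Suc i, d, e) else None)"
| "conv_step (Some (i, d, e)) (Some _, None) = (if e = 0 then Some (i, Suc d, e) else None)"
| "conv_step (Some (i, d, e)) (None, Some _) = (if d = 0 then Some (i, d, Suc e) else None)"
| "conv_step _ _ = None"

lemma conv_unary:
  "conv (unary (i + d)) (unary i) =
     replicate i (Some LetA, Some LetA) @ replicate d (Some LetA, None)"
  "conv (unary i) (unary (i + e)) =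
     replicate i (Some LetA, Some LetA) @ replicate e (None, Some LetA)"
  by (auto simp: conv_def intro!: nth_equalityI simp: nth_append)

text \<open>A surviving run determines the whole word read; words that are no convolutions end in
  \<open>None\<close>.\<close>

lemma run_conv_step_eq_Some:
  "foldl conv_step (Some (0, 0, 0)) w = Some (i, d, e) \<Longrightarrow>
     (d = 0 \<or> e = 0) \<and> w = conv (unary (i + d)) (unary (i + e))"
proof (induction w arbitrary: i d e rule: rev_induct)
  case Nil
  then show ?case by (simp add: conv_def)
next
  case (snoc c w)
  then obtain i' d' e' where
    s: "foldl conv_step (Some (0, 0, 0)) w = Some (i', d', e')"
    and c: "conv_step (Some (i', d', e')) c = Some (i, d, e)"
    by (cases "foldl conv_step (Some (0, 0, 0)) w") auto
  have c_cases: "c \<in> {(Some LetA, Some LetA), (Some LetA, None), (None, Some LetA)}"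
    using c letter.exhaust by (cases "(Some (i', d', e'), c)" rule: conv_step.cases) auto
  have rep: "replicate k x @ [x] = x # replicate k x" for k and x :: "letter option \<times> letter option"
    by (simp add: replicate_append_same)
  from snoc.IH[OF s] c c_cases show ?case
    using conv_unary(1)[of i d] conv_unary(2)[of i e] conv_unary(1)[of i' d']
      conv_unary(2)[of i' e']
    by (auto simp: rep split: if_splits)
qed

lemma run_conv_step_conv:
  assumes "d = 0 \<or> e = 0"
  shows "foldl conv_step (Some (0, 0, 0)) (conv (unary (i + d)) (unary (i + e))) = Some (i, d, e)"
proof -
  have 1: "foldl conv_step (Some (i, 0, 0)) (replicate k (Some LetA, Some LetA)) = Some (i + k, 0, 0)"
    for i k by (induction k arbitrary: i) simp_all
  have 2: "foldl conv_step (Some (i, d, 0)) (replicate k (Some LetA, None)) = Some (i, d + k, 0)"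
    for i d k by (induction k arbitrary: d) simp_all
  have 3: "foldl conv_step (Some (i, 0, e)) (replicate k (None, Some LetA)) = Some (i, 0, e + k)"
    for i e k by (induction k arbitrary: e) simp_all
  show ?thesis
    using assms conv_unary[of i] by (auto simp: 1 2 3)
qed

lemma conv_in_image_iff:
  fixes R :: "(letter list \<times> letter list) set"
  shows "w \<in> (\<lambda>(u, v). conv u v) ` R \<longleftrightarrow>
    (\<exists>i d e. foldl conv_step (Some (0, 0, 0)) w = Some (i, d, e) \<and> (unary (i + d), unary (i + e)) \<in> R)"
proof
  assume "w \<in> (\<lambda>(u, v). conv u v) ` R"
  then obtain u v where uv: "(u, v) \<in> R" "w = conv u v" by auto
  define i where "i = min (length u) (length v)"
  have "u = unary (i + (length u - i))" "v = unary (i + (length v - i))"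
    unfolding i_def by simp_all
  moreover have "length u - i = 0 \<or> length v - i = 0" by (auto simp: i_def)
  ultimately show "\<exists>i d e. foldl conv_step (Some (0, 0, 0)) w = Some (i, d, e) \<and>
      (unary (i + d), unary (i + e)) \<in> R"
    using run_conv_step_conv[of "length u - i" "length v - i" i] uv by metis
next
  assume "\<exists>i d e. foldl conv_step (Some (0, 0, 0)) w = Some (i, d, e) \<and>
      (unary (i + d), unary (i + e)) \<in> R"
  then show "w \<in> (\<lambda>(u, v). conv u v) ` R"
    using run_conv_step_eq_Some by force
qed

lemma conv_unary_in_image_iff:
  "conv (unary i) (unary j) \<in> (\<lambda>(u, v). conv u v) ` R \<longleftrightarrow> (unary i, unary j) \<in> R"
proof -
  define m where "m = min i j"
  have eq: "m + (i - m) = i" "m + (j - m) = j" and "i - m = 0 \<or> j - m = 0"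
    by (auto simp: m_def)
  then have "foldl conv_step (Some (0, 0, 0)) (conv (unary i) (unary j)) = Some (m, i - m, j - m)"
    using run_conv_step_conv[of "i - m" "j - m" m] by simp
  then show ?thesis unfolding conv_in_image_iff using eq by simp
qed

lemma regular_rel_unary_iff:
  "regular_rel R \<longleftrightarrow> (\<exists>p>0. periodic_rel p {(i, j). (unary i, unary j) \<in> R})"
  (is "_ \<longleftrightarrow> (\<exists>p>0. periodic_rel p ?R)")
proof
  assume "regular_rel R"
  then obtain n F and \<delta> :: "nat \<Rightarrow> letter option \<times> letter option \<Rightarrow> nat"
    where n: "0 < n" "\<forall>q<n. \<forall>c. \<delta> q c < n"
    and L: "(\<lambda>(u, v). conv u v) ` R = {w. foldl \<delta> 0 w \<in> F}"
    unfolding regular_rel_def regular_lang_def by blast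
  have lt: "foldl \<delta> 0 w < n" for w
    by (induction w rule: rev_induct) (use n in auto)
  \<comment> \<open>A run of at least \<open>fact n\<close> equal letters may grow by
    \<open>fact n\<close> without changing the state reached. Applied to the common prefix this
    gives the diagonal shift, applied to the padded tail the lengthening of the larger
    entry.\<close>
  have per: "foldl \<delta> 0 (w @ replicate (k + fact n) c) = foldl \<delta> 0 (w @ replicate k c)"
    if "fact n \<le> k" for w k c
    using funpow_eventually_periodic[of n "\<lambda>q. \<delta> q c" "foldl \<delta> 0 w" k] that fact_ge_self[of n] n lt[of w]
    by (simp add: foldl_replicate)
  have mem: "(i, j) \<in> ?R \<longleftrightarrow> foldl \<delta> 0 (conv (unary i) (unary j)) \<in> F" for i j
    using conv_unary_in_image_iff[of i j R] by (simp add: L)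
  have "periodic_rel (fact n) ?R"
    unfolding periodic_rel_def
  proof (intro conjI allI impI)
    fix i j :: nat
    assume ij: "fact n \<le> i" "fact n \<le> j"
    show "(i + fact n, j + fact n) \<in> ?R \<longleftrightarrow> (i, j) \<in> ?R"
    proof (cases "i \<le> j")
      case True
      then obtain d where d: "j = i + d" using le_Suc_ex by blast
      have "conv (unary (i + fact n)) (unary (j + fact n)) =
          replicate (i + fact n) (Some LetA, Some LetA) @ replicate d (None, Some LetA)"
        using conv_unary(2)[of "i + fact n" d] by (simp add: d ac_simps)
      then show ?thesis
        unfolding mem using conv_unary(2)[of i d] per[of i "[]"] ij
        by (simp add: d)
    next
      case False
      then obtain d where d: "i = j + d" using le_Suc_ex nat_le_linear by blast
      have "conv (unary (i + fact n)) (unary (j + fact n)) =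
          replicate (j + fact n) (Some LetA, Some LetA) @ replicate d (Some LetA, None)"
        using conv_unary(1)[of "j + fact n" d] by (simp add: d ac_simps)
      then show ?thesis
        unfolding mem using conv_unary(1)[of j d] per[of j "[]"] ij
        by (simp add: d)
    qed
  next
    fix i j :: nat
    assume "i + fact n \<le> j"
    then obtain d where d: "j = i + d" "fact n \<le> d"
      by (metis add_le_cancel_left le_add1 le_Suc_ex le_trans)
    show "(i, j + fact n) \<in> ?R \<longleftrightarrow> (i, j) \<in> ?R"
      unfolding mem using conv_unary(2)[of i d] conv_unary(2)[of i "d + fact n"] per[OF d(2)]
      by (simp add: d(1) add.assoc)
    show "(j + fact n, i) \<in> ?R \<longleftrightarrow> (j, i) \<in> ?R"
      unfolding mem using conv_unary(1)[of i d] conv_unary(1)[of i "d + fact n"] per[OF d(2)]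
      by (simp add: d(1) add.assoc)
  qed
  then show "\<exists>p>0. periodic_rel p ?R" using fact_gt_zero by blast
next
  assume "\<exists>p>0. periodic_rel p ?R"
  then obtain p where p: "0 < p" and R: "periodic_rel p ?R" by blast
  let ?c = "residue_class p"
  let ?run = "foldl conv_step (Some (0, 0, 0))"
  \<comment> \<open>Keeping only the residue classes of the three counters leaves finitely many
    states.\<close>
  let ?q = "map_option (map_prod ?c (map_prod ?c ?c))"
  show "regular_rel R"
    unfolding regular_rel_def
  proof (rule regular_langI[where h = "\<lambda>w. ?q (?run w)"])
    have "range (\<lambda>w. ?q (?run w)) \<subseteq>
        insert None (Some ` ({..<2 * p} \<times> {..<2 * p} \<times> {..<2 * p}))"
    proof
      fix x assume "x \<in> range (\<lambda>w. ?q (?run w))"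
      then obtain w where "x = ?q (?run w)" by blast
      then show "x \<in> insert None (Some ` ({..<2 * p} \<times> {..<2 * p} \<times> {..<2 * p}))"
        using residue_class_less[OF p] by (cases "?run w") auto
    qed
    then show "finite (range (\<lambda>w. ?q (?run w)))"
      by (rule finite_subset) simp
  next
    fix u v :: "(letter option \<times> letter option) list" and c
    have step: "?q (conv_step s c) = ?q (conv_step t c)" if st: "?q s = ?q t" for s t
    proof (cases s)
      case None
      then show ?thesis using st by simp
    next
      case (Some s')
      obtain i d e where s: "s = Some (i, d, e)" using Some by (cases s') auto
      then obtain i' d' e' where t: "t = Some (i', d', e')" "?c i = ?c i'" "?c d = ?c d'" "?c e = ?c e'"
        using st by (cases t) auto
      \<comment> \<open>The tests of \<open>conv_step\<close> compare \<open>d\<close> and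
        \<open>e\<close> with 0, and 0 is the only number in its residue class, so the abstract
        state still decides them.\<close>
      have "d = 0 \<longleftrightarrow> d' = 0" "e = 0 \<longleftrightarrow> e' = 0"
        using t residue_class_0_iff[OF p] by metis+
      moreover have "?c (Suc i) = ?c (Suc i')" "?c (Suc d) = ?c (Suc d')" "?c (Suc e) = ?c (Suc e')"
        using t residue_class_Suc[OF p] by blast+
      ultimately show ?thesis using t s
        by (cases "(s, c)" rule: conv_step.cases) auto
    qed
    show "?q (?run u) = ?q (?run v) \<Longrightarrow> ?q (?run (u @ [c])) = ?q (?run (v @ [c]))"
      using step[of "?run u" "?run v"] by simp
  next
    fix u v
    assume q: "?q (?run u) = ?q (?run v)" and "u \<in> (\<lambda>(u, v). conv u v) ` R"
    then obtain i d e where u: "?run u = Some (i, d, e)" and ide: "(i + d, i + e) \<in> ?R"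
      unfolding conv_in_image_iff by auto
    then obtain i' d' e' where v: "?run v = Some (i', d', e')"
      and c: "?c i = ?c i'" "?c d = ?c d'" "?c e = ?c e'"
      using q by (cases "?run v") auto
    \<comment> \<open>The counters are replaced one after the other: first the common part
      \<open>i\<close> by the diagonal shift, then the nonzero difference by lengthening the larger
      entry.\<close>
    have red: "(i + d, i + e) \<in> ?R \<longleftrightarrow> (?c i + ?c d, ?c i + ?c e) \<in> ?R" if "d = 0 \<or> e = 0" for i d e
    proof -
      have 1: "(?c i + d, ?c i + e) \<in> ?R \<longleftrightarrow> (i + d, i + e) \<in> ?R" for d e
      proof (rule residue_class_cong[OF p])
        fix n assume "p \<le> n"
        then show "(n + p + d, n + p + e) \<in> ?R \<longleftrightarrow> (n + d, n + e) \<in> ?R"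
          using periodic_relD(1)[OF R, of "n + d" "n + e"] by (simp add: ac_simps)
      qed
      have 2: "(i + ?c d, i) \<in> ?R \<longleftrightarrow> (i + d, i) \<in> ?R" for i d
      proof (rule residue_class_cong[OF p])
        fix n assume "p \<le> n"
        then show "(i + (n + p), i) \<in> ?R \<longleftrightarrow> (i + n, i) \<in> ?R"
          using periodic_relD(3)[OF R, of "i" "i + n"] by (simp add: ac_simps)
      qed
      have 3: "(i, i + ?c e) \<in> ?R \<longleftrightarrow> (i, i + e) \<in> ?R" for i e
      proof (rule residue_class_cong[OF p])
        fix n assume "p \<le> n"
        then show "(i, i + (n + p)) \<in> ?R \<longleftrightarrow> (i, i + n) \<in> ?R"
          using periodic_relD(2)[OF R, of "i" "i + n"] by (simp add: ac_simps)
      qed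
      have c0: "?c 0 = 0" using p by simp
      from that show ?thesis
      proof
        assume "d = 0"
        then show ?thesis using 1[of 0 e] 3[of "?c i" e] c0 by simp
      next
        assume "e = 0"
        then show ?thesis using 1[of d 0] 2[of "?c i" d] c0 by simp
      qed
    qed
    have "(i' + d', i' + e') \<in> ?R"
      using red[of d e i] red[of d' e' i'] ide run_conv_step_eq_Some[OF u] run_conv_step_eq_Some[OF v]
      unfolding c by blast
    then show "v \<in> (\<lambda>(u, v). conv u v) ` R"
      unfolding conv_in_image_iff using v by auto
  qed
qed

text \<open>Presentability read off from the lengths of words. The single \<open>p\<close> for
  domain, equality and edges is a common multiple of the three periods that regularity
  provides.\<close>

definition nat_presentation ::
    "nat \<Rightarrow> nat set \<Rightarrow> (nat \<Rightarrow> 'v) \<Rightarrow> 'v set \<Rightarrow> ('v \<times> 'v) set \<Rightarrow> bool" where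
  "nat_presentation p S f V E \<longleftrightarrow> 0 < p \<and> periodic_set p S \<and> f ` S = V \<and>
     periodic_rel p {(i, j). i \<in> S \<and> j \<in> S \<and> f i = f j} \<and>
     periodic_rel p {(i, j). i \<in> S \<and> j \<in> S \<and> (f i, f j) \<in> E}"

lemma unary_FA_presentable_iff:
  "unary_FA_presentable V E \<longleftrightarrow> (\<exists>p S f. nat_presentation p S f V E)"
proof
  assume "unary_FA_presentable V E"
  then obtain L :: "letter list set" and \<phi> where L: "regular_lang L" "\<phi> ` L = V"
    "regular_rel {(u, v). u \<in> L \<and> v \<in> L \<and> \<phi> u = \<phi> v}"
    "regular_rel {(u, v). u \<in> L \<and> v \<in> L \<and> (\<phi> u, \<phi> v) \<in> E}"
    unfolding unary_FA_presentable_def by blast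
  define S where "S = {n. unary n \<in> L}"
  define f where "f n = \<phi> (unary n)" for n
  obtain p1 where p1: "0 < p1" "periodic_set p1 S"
    using L(1) unfolding regular_lang_unary_iff S_def by blast
  obtain p2 where p2: "0 < p2" "periodic_rel p2 {(i, j). i \<in> S \<and> j \<in> S \<and> f i = f j}"
    using L(3) unfolding regular_rel_unary_iff S_def f_def by auto
  obtain p3 where p3: "0 < p3" "periodic_rel p3 {(i, j). i \<in> S \<and> j \<in> S \<and> (f i, f j) \<in> E}"
    using L(4) unfolding regular_rel_unary_iff S_def f_def by auto
  have "f ` S = \<phi> ` L"
  proof -
    have "unary ` S = L" unfolding S_def by (auto simp: image_iff) (metis unary_length)
    then show ?thesis unfolding f_def by (metis image_image)
  qed
  then have "nat_presentation (p1 * p2 * p3) S f V E"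
    unfolding nat_presentation_def
    using p1 p2 p3 L(2) periodic_set_mult[OF p1(2), of "p2 * p3"]
      periodic_rel_mult[OF p2(2), of "p1 * p3"] periodic_rel_mult[OF p3(2), of "p1 * p2"]
    by (simp add: ac_simps)
  then show "\<exists>p S f. nat_presentation p S f V E" by blast
next
  assume "\<exists>p S f. nat_presentation p S f V E"
  then obtain p S f where "nat_presentation p S f V E" by blast
  note * = this[unfolded nat_presentation_def]
  define L where "L = unary ` S"
  define \<phi> where "\<phi> w = f (length w)" for w :: "letter list"
  have mem: "unary n \<in> L \<longleftrightarrow> n \<in> S" for n
    unfolding L_def by (auto simp: image_iff)
  have "regular_lang L" unfolding regular_lang_unary_iff mem using * by auto
  moreover have "\<phi> ` L = V" using * by (simp add: L_def \<phi>_def image_image)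
  moreover have "regular_rel {(u, v). u \<in> L \<and> v \<in> L \<and> \<phi> u = \<phi> v}"
    unfolding regular_rel_unary_iff using * by (auto simp: mem \<phi>_def)
  moreover have "regular_rel {(u, v). u \<in> L \<and> v \<in> L \<and> (\<phi> u, \<phi> v) \<in> E}"
    unfolding regular_rel_unary_iff using * by (auto simp: mem \<phi>_def)
  ultimately show "unary_FA_presentable V E"
    unfolding unary_FA_presentable_def by blast
qed

section \<open>Classes of periodic graphs on the natural numbers\<close>

lemma mod_eq_le_nat:
  fixes x y m :: nat
  assumes "x mod m = y mod m" "x \<le> y"
  obtains k where "y = x + k * m"
proof -
  have "m dvd y - x" using mod_eq_dvd_iff_nat[of x y m] assms by simp
  then obtain k where "y - x = m * k" by blast
  then show thesis using that[of k] assms(2) by (simp add: mult.commute)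
qed

text \<open>Beyond \<open>N\<close>, along each residue class modulo \<open>q\<close>, membership
  can only switch from false to true, and at most once. So there are finitely many switching points,
  collected in \<open>B\<close>, and past them adding \<open>q\<close> does not affect
  membership.\<close>

lemma periodic_set_of_eventually_closed:
  fixes M :: "nat set"
  assumes q: "0 < q" and closed: "\<And>n. N \<le> n \<Longrightarrow> n \<in> M \<Longrightarrow> n + q \<in> M"
  shows "\<exists>k>0. periodic_set (k * q) M"
proof -
  have add: "n + k * q \<in> M" if "N \<le> n" "n \<in> M" for n k
  proof (induction k)
    case (Suc k)
    then show ?case using closed[of "n + k * q"] that by (simp add: ac_simps)
  qed (use that in simp)
  define B where "B = {n. N \<le> n \<and> n \<notin> M \<and> n + q \<in> M}"
  have no: "\<not> x < y" if xy: "x \<in> B" "y \<in> B" "x mod q = y mod q" for x y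
  proof
    assume "x < y"
    then obtain k where k: "y = x + k * q" using mod_eq_le_nat[OF xy(3)] by auto
    then have "k \<noteq> 0" using \<open>x < y\<close> by auto
    then obtain k' where "k = Suc k'" using not0_implies_Suc by blast
    then have "y = (x + q) + k' * q" using k by simp
    then show False using add[of "x + q" k'] xy(1,2) by (simp add: B_def)
  qed
  have "inj_on (\<lambda>n. n mod q) B"
    by (intro inj_onI) (metis no linorder_cases)
  moreover have "finite ((\<lambda>n. n mod q) ` B)"
    by (rule finite_subset[of _ "{..<q}"]) (use q in auto)
  ultimately have "finite B" using finite_imageD by blast
  then obtain b where b: "\<forall>n\<in>B. n < b" using finite_nat_set_iff_bounded by blast
  have iff: "n + q \<in> M \<longleftrightarrow> n \<in> M" if "N + b \<le> n" for n
  proof -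
    have "n \<notin> B" using that b by fastforce
    then show ?thesis using that closed[of n] by (auto simp: B_def)
  qed
  have iff': "n + k * q \<in> M \<longleftrightarrow> n \<in> M" if "N + b \<le> n" for n k
  proof (induction k)
    case (Suc k)
    then show ?case using iff[of "n + k * q"] that by (simp add: ac_simps)
  qed simp
  \<comment> \<open>Threshold and period are one number in \<open>periodic_set\<close>, so the
    multiple of \<open>q\<close> is chosen large enough to pass \<open>N + b\<close>.\<close>
  define k where "k = Suc (N + b)"
  have "k \<le> k * q" using q by simp
  then have "N + b \<le> k * q" by (simp add: k_def)
  then have "periodic_set (k * q) M" unfolding periodic_set_def using iff' by simp
  moreover have "0 < k" by (simp add: k_def)
  ultimately show ?thesis by blast
qed

locale periodic_graph =
  fixes p :: nat and R :: "(nat \<times> nat) set"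
  assumes p_pos: "0 < p" and periodic: "periodic_rel p R" and sym: "sym R"
begin

text \<open>Connectedness by paths that stay in \<open>{p..}\<close>, where every edge, and hence
  every path, can be shifted by \<open>p\<close>. A number below \<open>p\<close> is related to
  itself only.\<close>

definition T :: "(nat \<times> nat) set" where
  "T = (R \<inter> {p..} \<times> {p..})\<^sup>*"

lemma sym_T: "(i, j) \<in> T \<Longrightarrow> (j, i) \<in> T"
proof -
  have "sym (R \<inter> {p..} \<times> {p..})" using sym by (auto simp: sym_def)
  then show "(i, j) \<in> T \<Longrightarrow> (j, i) \<in> T" unfolding T_def by (meson sym_rtrancl symD)
qed

lemma trans_T: "(i, j) \<in> T \<Longrightarrow> (j, k) \<in> T \<Longrightarrow> (i, k) \<in> T"
  unfolding T_def by simp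

lemma refl_T [simp]: "(i, i) \<in> T"
  unfolding T_def by simp

lemma T_I: "(i, j) \<in> R \<Longrightarrow> p \<le> i \<Longrightarrow> p \<le> j \<Longrightarrow> (i, j) \<in> T"
  unfolding T_def by auto

lemma T_shift: "(i, j) \<in> T \<Longrightarrow> (i + k * p, j + k * p) \<in> T"
  unfolding T_def
proof (induction rule: rtrancl_induct)
  case (step y z)
  then have "(y + k * p, z + k * p) \<in> R \<inter> {p..} \<times> {p..}"
    using periodic_rel_add_mult(1)[OF periodic, of y z k] by auto
  with step.IH show ?case by (rule rtrancl_into_rtrancl)
qed simp

text \<open>Shifting the path from \<open>x\<close> to \<open>i\<close> joins
  \<open>x + k * p\<close> to \<open>i + k * p\<close>; so one translation valid at a single member
  is valid on the whole class.\<close>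

lemma T_translate:
  assumes "(x, x + k * p) \<in> T" "(x, i) \<in> T"
  shows "(i, i + k * p) \<in> T"
  using T_shift[OF assms(2), of k] assms trans_T sym_T by blast

lemma T_translate_mult:
  assumes "(i, i + k * p) \<in> T"
  shows "(i, i + m * k * p) \<in> T"
proof (induction m)
  case (Suc m)
  have "(i + m * k * p, i + m * k * p + k * p) \<in> T"
    using T_translate[OF assms Suc] .
  then show ?case using trans_T[OF Suc] by (simp add: algebra_simps)
qed simp

lemma infinite_class_if_translate:
  assumes "(i, i + k * p) \<in> T" "0 < k"
  shows "infinite (T `` {i})"
proof
  assume "finite (T `` {i})"
  moreover have "range (\<lambda>m. i + m * k * p) \<subseteq> T `` {i}"
    using T_translate_mult[OF assms(1)] by auto
  ultimately have "finite (range (\<lambda>m. i + m * k * p))" by (rule rev_finite_subset)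
  moreover have "inj (\<lambda>m. i + m * k * p)" using assms(2) p_pos by (auto intro!: injI)
  ultimately show False using finite_imageD by blast
qed

lemma card_finite_class:
  assumes fin: "finite (T `` {i})"
  shows "card (T `` {i}) \<le> p"
proof -
  have no: "\<not> x < y" if xy: "(i, x) \<in> T" "(i, y) \<in> T" "x mod p = y mod p" for x y
  proof
    assume "x < y"
    then obtain k where k: "y = x + k * p" using mod_eq_le_nat[OF xy(3)] by auto
    then have "0 < k" using \<open>x < y\<close> by (auto intro: gr0I)
    have "(x, x + k * p) \<in> T" using xy k trans_T sym_T by blast
    then have "(i, i + k * p) \<in> T" using T_translate sym_T xy(1) by blast
    then show False using infinite_class_if_translate \<open>0 < k\<close> fin by blast
  qed
  have "inj_on (\<lambda>x. x mod p) (T `` {i})"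
    by (intro inj_onI) (metis no Image_singleton_iff linorder_cases)
  then have "card (T `` {i}) \<le> card {..<p}"
    by (rule card_inj_on_le) (use p_pos in auto)
  then show ?thesis by simp
qed

text \<open>Every \<open>k * p\<close> with \<open>0 < k\<close> and \<open>k \<le> p\<close>
  divides \<open>q\<close>, so this one translation serves all infinite classes of
  \<open>T\<close>.\<close>

definition q :: nat where "q = fact p * p"

lemma q_pos: "0 < q"
  using p_pos by (simp add: q_def)

text \<open>An edge of length at least \<open>p\<close> in the class can be lengthened by \<open>p\<close>, which gives a
  translation by \<open>p\<close>. Otherwise the class meets each of the windows
  \<open>{i + t * p..<i + (t + 1) * p}\<close> for \<open>t \<le> p\<close>, and two of these \<open>p + 1\<close> elements are
  congruent modulo \<open>p\<close>.\<close>

lemma infinite_class_translate: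
  assumes inf: "infinite (T `` {i})"
  shows "\<exists>k. 0 < k \<and> k \<le> p \<and> (i, i + k * p) \<in> T"
proof (cases "\<exists>x y. (i, x) \<in> T \<and> (x, y) \<in> R \<and> p \<le> x \<and> x + p \<le> y")
  case True
  then obtain x y where xy: "(i, x) \<in> T" "(x, y) \<in> R" "p \<le> x" "x + p \<le> y" by blast
  then have "(x, y + p) \<in> R" using periodic_relD(2)[OF periodic] by blast
  then have "(x, y) \<in> T" "(x, y + 1 * p) \<in> T" using xy T_I by auto
  then have "(y, y + 1 * p) \<in> T" "(y, i) \<in> T" using xy(1) sym_T trans_T by blast+
  then have "(i, i + 1 * p) \<in> T" by (rule T_translate)
  then show ?thesis using p_pos by (intro exI[of _ 1]) simp
next
  case False
  have window: "\<exists>z. (i, z) \<in> T \<and> y \<le> z \<and> z < y + p" if "i \<le> y" for y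
  proof (cases "y = i")
    case True
    then show ?thesis using p_pos by (intro exI[of _ i]) simp
  next
    case iy: False
    obtain z where z: "(i, z) \<in> T" "y \<le> z"
      using inf by (meson Image_singleton_iff finite_nat_set_iff_bounded_le nat_le_linear)
    \<comment> \<open>Follow the path from \<open>i\<close>, which starts below \<open>y\<close>.
      Its first vertex at or above \<open>y\<close> exceeds its predecessor by less than
      \<open>p\<close>, hence lies in the window.\<close>
    from z(1) have "y \<le> z \<longrightarrow> ?thesis"
      unfolding T_def
    proof (induction rule: rtrancl_induct)
      case base
      then show ?case using iy that by simp
    next
      case (step x z)
      have x: "(i, x) \<in> T" "(i, z) \<in> T"
        using step.hyps by (auto simp: T_def intro: rtrancl_into_rtrancl)
      then have "\<not> x + p \<le> z" using False step.hyps by auto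
      then show ?case using step.IH x(2)
        unfolding T_def by (metis add_less_cancel_right leI less_le_trans linorder_not_less nat_le_linear order.strict_trans)
    qed
    then show ?thesis using z(2) by blast
  qed
  have "\<forall>t. \<exists>z. (i, z) \<in> T \<and> i + t * p \<le> z \<and> z < i + t * p + p"
    using window by simp
  then obtain z where z: "(i, z t) \<in> T" "i + t * p \<le> z t" "z t < i + t * p + p" for t
    by metis
  have "\<not> inj_on (\<lambda>t. z t mod p) {..p}"
  proof
    assume "inj_on (\<lambda>t. z t mod p) {..p}"
    then have "card {..p} \<le> card {..<p}"
      by (rule card_inj_on_le) (use p_pos in auto)
    then show False by simp
  qed
  then obtain s t where st: "s < t" "t \<le> p" "z s mod p = z t mod p"
    unfolding inj_on_def by (metis atMost_iff linorder_neqE_nat)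
  have "s * p + p \<le> t * p"
    using st(1) by (metis Suc_leI add.commute mult_Suc mult_le_mono1)
  then have "z s < z t" using z(3)[of s] z(2)[of t] by linarith
  then obtain k where k: "z t = z s + k * p" using mod_eq_le_nat[OF st(3)] by auto
  have "0 < k" using k \<open>z s < z t\<close> by (auto intro: gr0I)
  \<comment> \<open>Both elements lie in \<open>{i..<i + (p + 1) * p}\<close>, so their distance
    \<open>k * p\<close> is less than \<open>(p + 1) * p\<close>.\<close>
  moreover have "k \<le> p"
  proof -
    have "t * p \<le> p * p" using st(2) by (rule mult_le_mono1)
    then have "k * p < p * p + p" using z(3)[of t] z(2)[of s] k by linarith
    then have "k * p < Suc p * p" by simp
    then show ?thesis using p_pos by (metis less_Suc_eq_le mult_less_cancel2)
  qed
  moreover have "(z s, z s + k * p) \<in> T"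
    using z(1)[of s] z(1)[of t] k sym_T trans_T by metis
  then have "(i, i + k * p) \<in> T" using T_translate sym_T z(1) by blast
  ultimately show ?thesis by blast
qed

lemma infinite_class_add_q:
  assumes "infinite (T `` {i})"
  shows "(i, i + q) \<in> T"
proof -
  obtain k where k: "0 < k" "k \<le> p" "(i, i + k * p) \<in> T"
    using infinite_class_translate[OF assms] by blast
  then have "k dvd fact p" by (intro dvd_fact) auto
  then obtain m where "fact p = m * k" by (metis dvd_def mult.commute)
  then show ?thesis using T_translate_mult[OF k(3), of m] by (simp add: q_def)
qed

lemma T_subset: "T \<subseteq> R\<^sup>*"
  unfolding T_def by (intro rtrancl_mono) auto

lemma sym_rtrancl_R: "(i, j) \<in> R\<^sup>* \<Longrightarrow> (j, i) \<in> R\<^sup>*"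
  using sym by (meson sym_rtrancl symD)

lemma class_eq: "(i, j) \<in> R\<^sup>* \<Longrightarrow> R\<^sup>* `` {i} = R\<^sup>* `` {j}"
  using sym_rtrancl_R by (auto intro: rtrancl_trans)

text \<open>Cut the path at its last vertex \<open>a\<close> below \<open>p\<close>, if there is
  one: after the edge from \<open>a\<close> to \<open>z\<close> it stays in
  \<open>{p..}\<close>.\<close>

lemma class_path_cases:
  assumes "(i, j) \<in> R\<^sup>*" "p \<le> i" "p \<le> j"
  shows "(i, j) \<in> T \<or> (\<exists>a z. a < p \<and> (i, a) \<in> R\<^sup>* \<and> (a, z) \<in> R \<and> (z, j) \<in> T)"
proof -
  \<comment> \<open>The disjunct \<open>j < p\<close> admits small intermediate vertices, which the
    induction along the path must pass through.\<close>
  from assms(1) have "j < p \<or> (i, j) \<in> T \<or> (\<exists>a z. a < p \<and> (i, a) \<in> R\<^sup>* \<and> (a, z) \<in> R \<and> (z, j) \<in> T)"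
  proof (induction rule: rtrancl_induct)
    case (step x y)
    show ?case
    proof (cases "y < p \<or> x < p")
      case True
      then show ?thesis using step.hyps refl_T by blast
    next
      case False
      then have "(x, y) \<in> T" using T_I step.hyps by simp
      then show ?thesis using step.IH False trans_T by blast
    qed
  qed simp
  then show ?thesis using assms(3) by simp
qed

lemma class_without_small:
  assumes "R\<^sup>* `` {i} \<inter> {..<p} = {}"
  shows "R\<^sup>* `` {i} = T `` {i}"
proof -
  have ge: "p \<le> j" if "(i, j) \<in> R\<^sup>*" for j
    using assms that by (auto simp: disjoint_iff not_less)
  then have "(i, j) \<in> T" if "(i, j) \<in> R\<^sup>*" for j
    using class_path_cases[OF that] that by (meson linorder_not_less rtrancl.rtrancl_refl)
  then show ?thesis using T_subset by blast
qed

text \<open>Beyond the finitely many elements of finite classes of \<open>T\<close> that meet \<open>{..<2 * p}\<close>,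
  an element \<open>n\<close> of a finite class of \<open>T\<close> is attached to a small vertex \<open>a\<close> through an edge
  of length at least \<open>p\<close>, which can be shifted at its far end.\<close>

lemma class_eventually_closed:
  assumes "infinite (R\<^sup>* `` {i})"
  shows "\<exists>N. \<forall>n\<ge>N. (i, n) \<in> R\<^sup>* \<longrightarrow> (i, n + q) \<in> R\<^sup>*"
proof -
  define B where "B = (\<Union>z\<in>{z. z < 2 * p \<and> finite (T `` {z})}. T `` {z})"
  have "finite B" unfolding B_def by simp
  then obtain b where b: "\<forall>n\<in>B. n < b" using finite_nat_set_iff_bounded by blast
  \<comment> \<open>A start of at least \<open>p\<close> is required by
    \<open>class_path_cases\<close>, so \<open>i\<close> is replaced by a large member of its
    class.\<close>
  obtain i' where i': "(i, i') \<in> R\<^sup>*" "p \<le> i'"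
    using assms by (meson Image_singleton_iff finite_nat_set_iff_bounded_le nat_le_linear)
  \<comment> \<open>If the class of \<open>n\<close> in \<open>T\<close> is finite and
    \<open>n\<close> is at least \<open>c\<close>, then \<open>T\<close> does not join
    \<open>i'\<close> to \<open>n\<close>, and the path between them must visit
    \<open>{..<p}\<close>.\<close>
  obtain c where c: "finite (T `` {i'}) \<longrightarrow> (\<forall>n\<in>T `` {i'}. n < c)"
    using finite_nat_set_iff_bounded by blast
  have "(i, n + q) \<in> R\<^sup>*" if n: "n \<ge> b + c + p" "(i, n) \<in> R\<^sup>*" for n
  proof (cases "infinite (T `` {n})")
    case True
    then show ?thesis
      using infinite_class_add_q[OF True] T_subset n(2) by (meson rtrancl_trans subsetD)
  next
    case False
    have "(i', n) \<in> R\<^sup>*" using i'(1) n(2) sym_rtrancl_R by (meson rtrancl_trans)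
    moreover have "(i', n) \<notin> T"
    proof
      assume "(i', n) \<in> T"
      then have "T `` {i'} = T `` {n}" using sym_T trans_T by blast
      moreover have "n \<in> T `` {n}" by simp
      ultimately have "n < c" using c False by metis
      then show False using n(1) by simp
    qed
    ultimately obtain a z where az: "a < p" "(i', a) \<in> R\<^sup>*" "(a, z) \<in> R" "(z, n) \<in> T"
      using class_path_cases[of i' n] i'(2) n(1) by auto
    have "2 * p \<le> z"
    proof (rule ccontr)
      assume "\<not> 2 * p \<le> z"
      moreover have "T `` {z} = T `` {n}" using az(4) sym_T trans_T by blast
      ultimately have "z \<in> {z. z < 2 * p \<and> finite (T `` {z})}" using False by simp
      then have "n \<in> B" unfolding B_def using az(4) by blast
      then show False using b n(1) by auto
    qed
    then have "(a, z + q) \<in> R"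
      using periodic_rel_add_mult(2)[OF periodic, of a z "fact p"] az(1,3) by (simp add: q_def)
    moreover have "(z + q, n + q) \<in> T" using T_shift[OF az(4), of "fact p"] by (simp add: q_def)
    ultimately show ?thesis using az(2) i'(1) T_subset
      by (meson rtrancl.rtrancl_into_rtrancl rtrancl_trans subsetD)
  qed
  then show ?thesis by blast
qed

lemma infinite_class_periodic:
  assumes "infinite (R\<^sup>* `` {i})"
  shows "\<exists>P>0. periodic_set P (R\<^sup>* `` {i})"
proof -
  obtain N where "\<And>n. N \<le> n \<Longrightarrow> n \<in> R\<^sup>* `` {i} \<Longrightarrow> n + q \<in> R\<^sup>* `` {i}"
    using class_eventually_closed[OF assms] by auto
  then obtain k where "0 < k" "periodic_set (k * q) (R\<^sup>* `` {i})"
    using periodic_set_of_eventually_closed[OF q_pos] by blast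
  then show ?thesis using q_pos by (intro exI[of _ "k * q"]) simp
qed

text \<open>Each infinite class contains a full progression of difference \<open>q\<close>. Two such
  progressions with the same residue modulo \<open>q\<close> meet, so there are at most
  \<open>q\<close> infinite classes.\<close>

lemma finite_infinite_classes: "finite {M \<in> range (\<lambda>i. R\<^sup>* `` {i}). infinite M}"
proof -
  define \<M> where "\<M> = {M \<in> range (\<lambda>i. R\<^sup>* `` {i}). infinite M}"
  have "\<exists>x. \<forall>k. x + k * q \<in> M" if M: "M \<in> \<M>" for M
  proof -
    obtain i where i: "M = R\<^sup>* `` {i}" "infinite M" using M by (auto simp: \<M>_def)
    then obtain N where N: "\<And>n. N \<le> n \<Longrightarrow> n \<in> M \<Longrightarrow> n + q \<in> M"
      using class_eventually_closed by auto
    obtain x where x: "x \<in> M" "N \<le> x"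
      using i(2) by (meson finite_nat_set_iff_bounded_le nat_le_linear)
    have "x + k * q \<in> M" for k
    proof (induction k)
      case (Suc k)
      then show ?case using N[of "x + k * q"] x(2) by (simp add: ac_simps)
    qed (use x in simp)
    then show ?thesis by blast
  qed
  then obtain c where c: "c M + k * q \<in> M" if "M \<in> \<M>" for M k by metis
  have eq: "M = M'" if MM: "M \<in> \<M>" "M' \<in> \<M>" "c M mod q = c M' mod q" "c M \<le> c M'" for M M'
  proof -
    obtain k where "c M' = c M + k * q" using mod_eq_le_nat[OF MM(3,4)] by blast
    then have "c M' \<in> M" "c M' \<in> M'" using c[of M k] c[of M' 0] MM(1,2) by simp_all
    moreover obtain i i' where "M = R\<^sup>* `` {i}" "M' = R\<^sup>* `` {i'}"
      using MM(1,2) by (auto simp: \<M>_def)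
    ultimately show ?thesis using class_eq by blast
  qed
  have "inj_on (\<lambda>M. c M mod q) \<M>"
    unfolding inj_on_def using eq by (metis nat_le_linear)
  moreover have "finite ((\<lambda>M. c M mod q) ` \<M>)"
    by (rule finite_subset[of _ "{..<q}"]) (use q_pos in auto)
  ultimately show ?thesis using finite_imageD \<M>_def by blast
qed

text \<open>A finite class avoiding \<open>{..<p}\<close> is a class of \<open>T\<close> and has at
  most \<open>p\<close> elements. Any other one is the class of some \<open>a < p\<close> and is
  covered by the sum, in which infinite classes count 0.\<close>

lemma finite_class_bound: "\<exists>b. \<forall>i. finite (R\<^sup>* `` {i}) \<longrightarrow> card (R\<^sup>* `` {i}) \<le> b"
proof -
  define b where "b = p + (\<Sum>a<p. card (R\<^sup>* `` {a}))"
  have "card (R\<^sup>* `` {i}) \<le> b" if fin: "finite (R\<^sup>* `` {i})" for i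
  proof (cases "R\<^sup>* `` {i} \<inter> {..<p} = {}")
    case True
    then show ?thesis using class_without_small[OF True] card_finite_class[of i] fin by (simp add: b_def)
  next
    case False
    then obtain a where a: "a < p" "(i, a) \<in> R\<^sup>*" by auto
    then have "card (R\<^sup>* `` {i}) = card (R\<^sup>* `` {a})" using class_eq by metis
    also have "\<dots> \<le> (\<Sum>a<p. card (R\<^sup>* `` {a}))" using a(1) by (intro member_le_sum) auto
    finally show ?thesis by (simp add: b_def)
  qed
  then show ?thesis by blast
qed

end

section \<open>Components\<close>

text \<open>For \<open>A \<subseteq> V\<close> this says that \<open>A\<close> is a union of
  components. Unlike being a component, it passes to unions, as gluing requires.\<close>

definition edge_closed :: "('v \<times> 'v) set \<Rightarrow> 'v set \<Rightarrow> bool" where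
  "edge_closed E A \<longleftrightarrow> (\<forall>(x, y) \<in> E. x \<in> A \<longleftrightarrow> y \<in> A)"

lemma edge_closed_UN: "(\<And>i. i \<in> I \<Longrightarrow> edge_closed E (A i)) \<Longrightarrow> edge_closed E (\<Union>i\<in>I. A i)"
  unfolding edge_closed_def by blast

lemma edge_closed_rtrancl:
  assumes "edge_closed E A" "(x, y) \<in> (E \<union> E\<inverse>)\<^sup>*"
  shows "x \<in> A \<longleftrightarrow> y \<in> A"
  using assms(2)
  by (induction rule: rtrancl_induct) (use assms(1) in \<open>auto simp: edge_closed_def\<close>)

lemma sym_rtrancl_Un_converse: "(x, y) \<in> (E \<union> E\<inverse>)\<^sup>* \<Longrightarrow> (y, x) \<in> (E \<union> E\<inverse>)\<^sup>*"
  by (meson sym_Un_converse sym_rtrancl symD)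

lemma component_eq:
  assumes "y \<in> component V E x"
  shows "component V E y = component V E x"
proof -
  have xy: "(x, y) \<in> (E \<union> E\<inverse>)\<^sup>*" using assms by (simp add: component_def)
  have "(y, z) \<in> (E \<union> E\<inverse>)\<^sup>* \<longleftrightarrow> (x, z) \<in> (E \<union> E\<inverse>)\<^sup>*" for z
    using rtrancl_trans[OF xy, of z] rtrancl_trans[OF sym_rtrancl_Un_converse[OF xy], of z] by blast
  then show ?thesis by (simp add: component_def)
qed

lemma components_disjoint:
  assumes "C \<in> components V E" "D \<in> components V E" "C \<noteq> D"
  shows "C \<inter> D = {}"
proof -
  obtain x y where C: "C = component V E x" and D: "D = component V E y"
    using assms by (auto simp: components_def)
  have "C = D" if "z \<in> C" "z \<in> D" for z
    using component_eq[OF that(1)[unfolded C]] component_eq[OF that(2)[unfolded D]] C D by simp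
  then show ?thesis using assms(3) by blast
qed

lemma mem_component_self: "x \<in> V \<Longrightarrow> x \<in> component V E x"
  by (simp add: component_def)

lemma Union_components: "\<Union> (components V E) = V"
  by (auto simp: components_def component_def)

lemma edge_closed_component:
  assumes "E \<subseteq> V \<times> V" "C \<in> components V E"
  shows "edge_closed E C"
proof -
  have "(a, c) \<in> (E \<union> E\<inverse>)\<^sup>* \<longleftrightarrow> (a, d) \<in> (E \<union> E\<inverse>)\<^sup>*" if "(c, d) \<in> E" for a c d
    using that by (meson UnI1 UnI2 converseI rtrancl.rtrancl_into_rtrancl)
  then show ?thesis
    using assms unfolding edge_closed_def components_def component_def by fastforce
qed

lemma directed_forest_subset:
  assumes "directed_forest V E" "C \<subseteq> V"
  shows "directed_forest C (E \<inter> C \<times> C)"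
proof -
  have "adj E x y" if "adj (E \<inter> C \<times> C) x y" for x y
    using that by (auto simp: adj_def)
  then have "\<not> (\<exists>cs. 3 \<le> length cs \<and> distinct cs \<and> set cs \<subseteq> C \<and>
      (\<forall>i. Suc i < length cs \<longrightarrow> adj (E \<inter> C \<times> C) (cs ! i) (cs ! Suc i)) \<and>
      adj (E \<inter> C \<times> C) (last cs) (hd cs))"
    using assms unfolding directed_forest_def by (meson order_trans)
  then show ?thesis
    using assms(1) unfolding directed_forest_def by blast
qed

lemma directed_tree_component:
  assumes forest: "directed_forest V E" and C: "C \<in> components V E"
  shows "directed_tree C (E \<inter> C \<times> C)"
proof -
  have EV: "E \<subseteq> V \<times> V" using forest by (simp add: directed_forest_def)
  obtain a where a: "a \<in> V" "C = component V E a" using C by (auto simp: components_def)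
  have CV: "C \<subseteq> V" using a by (auto simp: component_def)
  let ?E = "E \<inter> C \<times> C"
  have closed: "edge_closed E C" using edge_closed_component[OF EV C] .
  \<comment> \<open>A path that starts in \<open>C\<close> never leaves it, so restricting the edges
    to \<open>C\<close> does not break it.\<close>
  have path: "(x, y) \<in> (?E \<union> ?E\<inverse>)\<^sup>*" if "(x, y) \<in> (E \<union> E\<inverse>)\<^sup>*" "x \<in> C" for x y
    using that(1)
  proof (induction rule: rtrancl_induct)
    case (step y z)
    have "y \<in> C" "z \<in> C"
      using edge_closed_rtrancl[OF closed step.hyps(1)] that(2) closed step.hyps(2)
      by (auto simp: edge_closed_def)
    then have "(y, z) \<in> ?E \<union> ?E\<inverse>" using step.hyps(2) by auto
    with step.IH show ?case by (rule rtrancl_into_rtrancl)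
  qed simp
  have "(x, y) \<in> (E \<union> E\<inverse>)\<^sup>*" if "x \<in> C" "y \<in> C" for x y
    using that a sym_rtrancl_Un_converse[of a x E] unfolding component_def
    by (auto intro: rtrancl_trans)
  then have "\<forall>x\<in>C. \<forall>y\<in>C. (x, y) \<in> (?E \<union> ?E\<inverse>)\<^sup>*" using path by blast
  moreover have "C \<noteq> {}" using a mem_component_self[of a V E] by auto
  ultimately show ?thesis
    using directed_forest_subset[OF forest CV] by (simp add: directed_tree_def)
qed

section \<open>Components of a presentable graph\<close>

lemma nat_presentation_restrict:
  assumes pres: "nat_presentation p S f V E" and M: "M \<subseteq> S" "0 < P" "periodic_set P M"
  shows "nat_presentation (P * p) M f (f ` M) (E \<inter> f ` M \<times> f ` M)"
proof -
  note * = pres[unfolded nat_presentation_def]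
  have M': "periodic_set (P * p) M" using periodic_set_mult[OF M(3), of p] * by (simp add: mult.commute)
  have eq: "{(i, j). i \<in> M \<and> j \<in> M \<and> f i = f j} = {(i, j). i \<in> S \<and> j \<in> S \<and> f i = f j} \<inter> M \<times> M"
    "{(i, j). i \<in> M \<and> j \<in> M \<and> (f i, f j) \<in> E \<inter> f ` M \<times> f ` M} =
       {(i, j). i \<in> S \<and> j \<in> S \<and> (f i, f j) \<in> E} \<inter> M \<times> M"
    using M(1) by auto
  have "periodic_rel (P * p) {(i, j). i \<in> M \<and> j \<in> M \<and> f i = f j}"
    unfolding eq using * M(2) by (intro periodic_rel_restrict[OF _ M'] periodic_rel_mult) auto
  moreover have "periodic_rel (P * p) {(i, j). i \<in> M \<and> j \<in> M \<and> (f i, f j) \<in> E \<inter> f ` M \<times> f ` M}"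
    unfolding eq using * M(2) by (intro periodic_rel_restrict[OF _ M'] periodic_rel_mult) auto
  ultimately show ?thesis
    unfolding nat_presentation_def using M' * M(2) by simp
qed

text \<open>The classes of \<open>R\<close> on the names are exactly the preimages of the components
  under \<open>f\<close>, so the results on periodic graphs carry over.\<close>

lemma presentable_components:
  assumes "unary_FA_presentable V E" and EV: "E \<subseteq> V \<times> V"
  shows "finite {C \<in> components V E. infinite C}"
    and "\<And>C. C \<in> components V E \<Longrightarrow> infinite C \<Longrightarrow> unary_FA_presentable C (E \<inter> C \<times> C)"
    and "\<exists>b. \<forall>C \<in> components V E. finite C \<longrightarrow> card C \<le> b"
proof -
  obtain p S f where pres: "nat_presentation p S f V E"
    using assms(1) unfolding unary_FA_presentable_iff by blast
  note * = pres[unfolded nat_presentation_def]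
  define Q where "Q = {(i, j). i \<in> S \<and> j \<in> S \<and> (f i, f j) \<in> E}"
  define R where "R = {(i, j). i \<in> S \<and> j \<in> S \<and> f i = f j} \<union> (Q \<union> Q\<inverse>)"
  have "periodic_rel p R"
    unfolding R_def Q_def using * by (intro periodic_rel_Un periodic_rel_converse) auto
  moreover have "sym R" unfolding R_def by (auto simp: sym_def)
  ultimately interpret periodic_graph p R
    using * by unfold_locales auto
  have fS: "f ` S = V" using * by blast
  have R_path: "(f i, f j) \<in> (E \<union> E\<inverse>)\<^sup>*" if "(i, j) \<in> R" for i j
    using that by (auto simp: R_def Q_def)
  have class_eq_preimage: "R\<^sup>* `` {i} = {j \<in> S. f j \<in> component V E (f i)}" if i: "i \<in> S" for i
  proof (intro equalityI subsetI)
    fix j assume "j \<in> R\<^sup>* `` {i}"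
    then have "(i, j) \<in> R\<^sup>*" by simp
    then have "j \<in> S \<and> (f i, f j) \<in> (E \<union> E\<inverse>)\<^sup>*"
    proof (induction rule: rtrancl_induct)
      case base
      then show ?case using i by simp
    next
      case (step j k)
      then have "k \<in> S" by (auto simp: R_def Q_def)
      then show ?case using step.IH R_path[OF step.hyps(2)]
        by (meson rtrancl_trans)
    qed
    then show "j \<in> {j \<in> S. f j \<in> component V E (f i)}"
      using fS by (auto simp: component_def)
  next
    fix j assume "j \<in> {j \<in> S. f j \<in> component V E (f i)}"
    then have j: "j \<in> S" "(f i, f j) \<in> (E \<union> E\<inverse>)\<^sup>*" by (auto simp: component_def)
    \<comment> \<open>A path of vertices lifts to names only up to the choice of a name for each
      vertex, so the induction covers all names of the end point.\<close>
    have "\<forall>k\<in>S. f k = y \<longrightarrow> (i, k) \<in> R\<^sup>*" if "(f i, y) \<in> (E \<union> E\<inverse>)\<^sup>*" for y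
      using that
    proof (induction rule: rtrancl_induct)
      case base
      then show ?case using i by (auto simp: R_def)
    next
      case (step y z)
      have "y \<in> V" using step.hyps(2) EV by auto
      then obtain l where l: "l \<in> S" "f l = y" using fS by blast
      then have "(i, l) \<in> R\<^sup>*" using step.IH by blast
      moreover have "(l, k) \<in> R" if "k \<in> S" "f k = z" for k
        using that l step.hyps(2) by (auto simp: R_def Q_def)
      ultimately show ?case by (meson rtrancl.rtrancl_into_rtrancl)
    qed
    then show "j \<in> R\<^sup>* `` {i}" using j by blast
  qed
  have image: "\<exists>i\<in>S. C = f ` (R\<^sup>* `` {i})" if C: "C \<in> components V E" for C
  proof -
    obtain i where i: "i \<in> S" "C = component V E (f i)"
      using C fS by (auto simp: components_def)
    have "f ` {j \<in> S. f j \<in> component V E (f i)} = component V E (f i)"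
      using fS by (auto simp: component_def)
    then show ?thesis using i class_eq_preimage by auto
  qed
  have "finite ((`) f ` {M \<in> range (\<lambda>i. R\<^sup>* `` {i}). infinite M})" (is "finite ?F")
    using finite_infinite_classes by simp
  have large: "C \<in> ?F" if "C = f ` (R\<^sup>* `` {i})" "infinite (R\<^sup>* `` {i})" for C i
    using that by blast
  have "{C \<in> components V E. infinite C} \<subseteq> ?F"
    using image large by (blast dest: finite_imageI)
  then show "finite {C \<in> components V E. infinite C}"
    using \<open>finite ?F\<close> by (rule finite_subset)
  show "unary_FA_presentable C (E \<inter> C \<times> C)" if C: "C \<in> components V E" "infinite C" for C
  proof -
    obtain i where i: "i \<in> S" "C = f ` (R\<^sup>* `` {i})" using image[OF C(1)] by blast
    then have "infinite (R\<^sup>* `` {i})" using C(2) by auto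
    then obtain P where "0 < P" "periodic_set P (R\<^sup>* `` {i})"
      using infinite_class_periodic by blast
    moreover have "R\<^sup>* `` {i} \<subseteq> S" using class_eq_preimage[OF i(1)] by blast
    ultimately show ?thesis
      using nat_presentation_restrict[OF pres] i(2) unfolding unary_FA_presentable_iff by blast
  qed
  obtain b where b: "\<And>i. finite (R\<^sup>* `` {i}) \<Longrightarrow> card (R\<^sup>* `` {i}) \<le> b"
    using finite_class_bound by blast
  \<comment> \<open>A finite component may have infinitely many names, and then \<open>b\<close>
    says nothing about it. But it is then one of the finitely many members of \<open>?F\<close>, so
    the sum bounds it, with infinite members counting 0.\<close>
  have "card C \<le> b + sum card ?F" if C: "C \<in> components V E" for C
  proof -
    obtain i where i: "i \<in> S" "C = f ` (R\<^sup>* `` {i})" using image[OF C(1)] by blast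
    show ?thesis
    proof (cases "finite (R\<^sup>* `` {i})")
      case True
      then have "card C \<le> b" using i(2) b[OF True] card_image_le[OF True, of f] by simp
      then show ?thesis by simp
    next
      case False
      then have "card C \<le> sum card ?F"
        using \<open>finite ?F\<close> large[OF i(2)] by (intro member_le_sum) auto
      then show ?thesis by simp
    qed
  qed
  then show "\<exists>b. \<forall>C \<in> components V E. finite C \<longrightarrow> card C \<le> b" by blast
qed

section \<open>Disjoint unions of presentable graphs\<close>

lemma periodic_set_interleave:
  assumes "periodic_set p A" "periodic_set p B"
  shows "periodic_set (2 * p) {n. if even n then n div 2 \<in> A else n div 2 \<in> B}"
  unfolding periodic_set_def
proof (intro allI impI)
  fix n assume "2 * p \<le> n"
  then have "p \<le> n div 2" by simp
  then show "n + 2 * p \<in> {n. if even n then n div 2 \<in> A else n div 2 \<in> B} \<longleftrightarrow>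
      n \<in> {n. if even n then n div 2 \<in> A else n div 2 \<in> B}"
    using periodic_setD[OF assms(1), of "n div 2"] periodic_setD[OF assms(2), of "n div 2"]
    by (simp add: add.commute)
qed

text \<open>Adding \<open>2 * p\<close> preserves parity and adds \<open>p\<close> to the
  half.\<close>

lemma periodic_rel_interleave:
  assumes "periodic_rel p A" "periodic_rel p B"
  shows "periodic_rel (2 * p)
    {(i, j). even i \<and> even j \<and> (i div 2, j div 2) \<in> A \<or> odd i \<and> odd j \<and> (i div 2, j div 2) \<in> B}"
    (is "periodic_rel _ ?R")
  unfolding periodic_rel_def
proof (intro conjI allI impI)
  have div: "(n + 2 * p) div 2 = n div 2 + p" for n :: nat by simp
  {
    fix i j assume "2 * p \<le> i" "2 * p \<le> j"
    then have "p \<le> i div 2" "p \<le> j div 2" by simp_all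
    then show "(i + 2 * p, j + 2 * p) \<in> ?R \<longleftrightarrow> (i, j) \<in> ?R"
      using periodic_relD(1)[OF assms(1)] periodic_relD(1)[OF assms(2)] by (simp add: div)
  }
  fix i j assume "i + 2 * p \<le> j"
  then have "i div 2 + p \<le> j div 2" using div_le_mono[of "i + 2 * p" j 2] by (simp add: div)
  then show "(i, j + 2 * p) \<in> ?R \<longleftrightarrow> (i, j) \<in> ?R" "(j + 2 * p, i) \<in> ?R \<longleftrightarrow> (j, i) \<in> ?R"
    using periodic_relD(2,3)[OF assms(1)] periodic_relD(2,3)[OF assms(2)] by (simp_all add: div)
qed

text \<open>Even numbers name the vertices in \<open>V\<close>, odd ones those in \<open>W\<close>.
  By disjointness neither equality nor an edge relates numbers of different parity.\<close>

lemma presentable_Un: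
  assumes "unary_FA_presentable V E" "unary_FA_presentable W F"
    and disj: "V \<inter> W = {}" and E: "E \<subseteq> V \<times> V" and F: "F \<subseteq> W \<times> W"
  shows "unary_FA_presentable (V \<union> W) (E \<union> F)"
proof -
  obtain p1 S1 f1 p2 S2 f2
    where "nat_presentation p1 S1 f1 V E" "nat_presentation p2 S2 f2 W F"
    using assms(1,2) unfolding unary_FA_presentable_iff by blast
  note * = this[unfolded nat_presentation_def]
  define p where "p = p1 * p2"
  have p: "0 < p" using * by (simp add: p_def)
  define S where "S = {n. if even n then n div 2 \<in> S1 else n div 2 \<in> S2}"
  define f where "f n = (if even n then f1 (n div 2) else f2 (n div 2))" for n
  have per1: "periodic_set p S1" "periodic_rel p {(i, j). i \<in> S1 \<and> j \<in> S1 \<and> f1 i = f1 j}"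
    "periodic_rel p {(i, j). i \<in> S1 \<and> j \<in> S1 \<and> (f1 i, f1 j) \<in> E}"
    using * periodic_set_mult[of p1 S1 p2] periodic_rel_mult[of p1 _ p2]
    by (simp_all add: p_def mult.commute)
  have per2: "periodic_set p S2" "periodic_rel p {(i, j). i \<in> S2 \<and> j \<in> S2 \<and> f2 i = f2 j}"
    "periodic_rel p {(i, j). i \<in> S2 \<and> j \<in> S2 \<and> (f2 i, f2 j) \<in> F}"
    using * periodic_set_mult[of p2 S2 p1] periodic_rel_mult[of p2 _ p1]
    by (simp_all add: p_def mult.commute)
  have f1: "f1 i \<in> V" if "i \<in> S1" for i using that * by blast
  have f2: "f2 i \<in> W" if "i \<in> S2" for i using that * by blast
  have f12: "f1 i \<noteq> f2 j" "f2 j \<noteq> f1 i" "(f1 i, f2 j) \<notin> E \<union> F" "(f2 j, f1 i) \<notin> E \<union> F"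
    if "i \<in> S1" "j \<in> S2" for i j
    using f1[OF that(1)] f2[OF that(2)] disj E F by auto
  have f11: "(f1 i, k) \<notin> F" if "i \<in> S1" for i k using f1[OF that] disj F by auto
  have f22: "(f2 i, k) \<notin> E" if "i \<in> S2" for i k using f2[OF that] disj E by auto
  have img: "f ` S = V \<union> W"
  proof
    show "f ` S \<subseteq> V \<union> W" using f1 f2 by (auto simp: f_def S_def)
    have "f1 i \<in> f ` S" if "i \<in> S1" for i
      by (rule image_eqI[of _ _ "2 * i"]) (use that in \<open>auto simp: f_def S_def\<close>)
    moreover have "f2 i \<in> f ` S" if "i \<in> S2" for i
      by (rule image_eqI[of _ _ "2 * i + 1"]) (use that in \<open>auto simp: f_def S_def\<close>)
    ultimately show "V \<union> W \<subseteq> f ` S" using * by blast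
  qed
  have eq: "{(i, j). i \<in> S \<and> j \<in> S \<and> f i = f j} = {(i, j).
      even i \<and> even j \<and> (i div 2, j div 2) \<in> {(i, j). i \<in> S1 \<and> j \<in> S1 \<and> f1 i = f1 j} \<or>
      odd i \<and> odd j \<and> (i div 2, j div 2) \<in> {(i, j). i \<in> S2 \<and> j \<in> S2 \<and> f2 i = f2 j}}"
    using f12(1,2) by (auto simp: S_def f_def split: if_splits)
  have edge: "{(i, j). i \<in> S \<and> j \<in> S \<and> (f i, f j) \<in> E \<union> F} = {(i, j).
      even i \<and> even j \<and> (i div 2, j div 2) \<in> {(i, j). i \<in> S1 \<and> j \<in> S1 \<and> (f1 i, f1 j) \<in> E} \<or>
      odd i \<and> odd j \<and> (i div 2, j div 2) \<in> {(i, j). i \<in> S2 \<and> j \<in> S2 \<and> (f2 i, f2 j) \<in> F}}"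
    using f12(3,4) f11 f22 by (auto simp: S_def f_def split: if_splits)
  have "nat_presentation (2 * p) S f (V \<union> W) (E \<union> F)"
    unfolding nat_presentation_def eq edge
    using p img periodic_set_interleave[OF per1(1) per2(1)]
      periodic_rel_interleave[OF per1(2) per2(2)] periodic_rel_interleave[OF per1(3) per2(3)]
    by (simp add: S_def)
  then show ?thesis unfolding unary_FA_presentable_iff by blast
qed

lemma presentable_finite:
  assumes "finite V"
  shows "unary_FA_presentable V E"
proof -
  obtain f where f: "bij_betw f {0..<card V} V"
    using ex_bij_betw_nat_finite[OF assms] by blast
  \<comment> \<open>\<open>Suc\<close> keeps the period positive for empty \<open>V\<close>. All
    names are below the threshold, so both sides of every periodicity condition are false.\<close>
  have "nat_presentation (Suc (card V)) {0..<card V} f V E"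
    using f by (auto simp: nat_presentation_def periodic_set_def periodic_rel_def bij_betw_def)
  then show ?thesis unfolding unary_FA_presentable_iff by blast
qed

lemma presentable_UN:
  assumes "finite I"
    and "\<And>i. i \<in> I \<Longrightarrow> unary_FA_presentable (A i) (E \<inter> A i \<times> A i)"
    and "\<And>i. i \<in> I \<Longrightarrow> edge_closed E (A i)"
    and "\<And>i j. i \<in> I \<Longrightarrow> j \<in> I \<Longrightarrow> i \<noteq> j \<Longrightarrow> A i \<inter> A j = {}"
  shows "unary_FA_presentable (\<Union>i\<in>I. A i) (E \<inter> (\<Union>i\<in>I. A i) \<times> (\<Union>i\<in>I. A i))"
  using assms
proof (induction I rule: finite_induct)
  case empty
  then show ?case by (simp add: presentable_finite)
next
  case (insert i I)
  let ?U = "\<Union>i\<in>I. A i"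
  have "unary_FA_presentable ?U (E \<inter> ?U \<times> ?U)" using insert by simp
  moreover have "A i \<inter> ?U = {}" using insert.hyps(2) insert.prems(3)[of i] by fastforce
  ultimately have "unary_FA_presentable (A i \<union> ?U) ((E \<inter> A i \<times> A i) \<union> (E \<inter> ?U \<times> ?U))"
    using insert.prems(1)[of i] by (intro presentable_Un) auto
  moreover have "(E \<inter> A i \<times> A i) \<union> (E \<inter> ?U \<times> ?U) = E \<inter> (A i \<union> ?U) \<times> (A i \<union> ?U)"
    using insert.prems(2)[of i] \<open>A i \<inter> ?U = {}\<close> unfolding edge_closed_def by blast
  ultimately show ?case by simp
qed

text \<open>The number \<open>n\<close> names vertex \<open>n mod m\<close> of copy
  \<open>n div m\<close>. Names are unique and edges stay inside a block of length \<open>m\<close>,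
  so adding \<open>m\<close> to both entries moves to the next copy. The relation \<open>T\<close>
  is the common shape of the copies.\<close>

lemma presentable_copies:
  fixes m :: nat
  assumes "countable \<D>"
    and bij: "\<And>C. C \<in> \<D> \<Longrightarrow> bij_betw (g C) {..<m} C"
    and iso: "\<And>C i j. C \<in> \<D> \<Longrightarrow> i < m \<Longrightarrow> j < m \<Longrightarrow> (g C i, g C j) \<in> E \<longleftrightarrow> (i, j) \<in> T"
    and closed: "\<And>C. C \<in> \<D> \<Longrightarrow> edge_closed E C"
    and disj: "\<And>C D. C \<in> \<D> \<Longrightarrow> D \<in> \<D> \<Longrightarrow> C \<noteq> D \<Longrightarrow> C \<inter> D = {}"
  shows "unary_FA_presentable (\<Union>\<D>) (E \<inter> \<Union>\<D> \<times> \<Union>\<D>)"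
\<comment> \<open>Enumerating the copies by all natural numbers needs infinitely many of them, and
  blocks need positive length; otherwise the union is finite.\<close>
proof (cases "finite \<D> \<or> m = 0")
  case True
  have "finite C" if "C \<in> \<D>" for C
    using bij[OF that] by (metis bij_betw_finite finite_lessThan)
  moreover have "\<Union>\<D> = {}" if "m = 0" using bij that by (fastforce simp: bij_betw_def)
  ultimately have "finite (\<Union>\<D>)" using True by (metis finite.emptyI finite_Union)
  then show ?thesis by (rule presentable_finite)
next
  case False
  then have m: "0 < m" and inf: "infinite \<D>" by auto
  define e where "e = from_nat_into \<D>"
  have e: "bij_betw e UNIV \<D>"
    unfolding e_def using bij_betw_from_nat_into[OF assms(1) inf] .
  then have eD: "e k \<in> \<D>" for k by (auto simp: bij_betw_def)
  have e_eq: "e k = e l \<longleftrightarrow> k = l" for k l using e by (auto simp: bij_betw_def inj_eq)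
  define f where "f n = g (e (n div m)) (n mod m)" for n
  have fe: "f n \<in> e (n div m)" for n
    using bij[OF eD, of "n div m"] m by (auto simp: f_def bij_betw_def)
  have same: "n div m = n' div m" if "f n' \<in> e (n div m)" for n n'
    using that fe[of n'] disj[OF eD eD, of "n div m" "n' div m"] e_eq by blast
  have f_eq: "f n = f n' \<longleftrightarrow> n = n'" for n n'
  proof
    assume eq: "f n = f n'"
    then have "n div m = n' div m" using same fe by metis
    moreover from this have "n mod m = n' mod m"
      using eq bij[OF eD, of "n div m"] m by (auto simp: f_def bij_betw_def inj_on_def)
    ultimately show "n = n'" by (metis div_mult_mod_eq)
  qed simp
  have f_edge: "(f n, f n') \<in> E \<longleftrightarrow> n div m = n' div m \<and> (n mod m, n' mod m) \<in> T" for n n'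
  proof (cases "n div m = n' div m")
    case True
    then show ?thesis using iso[OF eD, of "n mod m" "n' mod m" "n' div m"] m by (simp add: f_def)
  next
    case False
    have "(f n, f n') \<notin> E"
    proof
      assume "(f n, f n') \<in> E"
      then have "f n' \<in> e (n div m)"
        using closed[OF eD, of "n div m"] fe[of n] by (auto simp: edge_closed_def)
      then show False using same False by blast
    qed
    then show ?thesis using False by simp
  qed
  have img: "range f = \<Union>\<D>"
  proof
    show "range f \<subseteq> \<Union>\<D>" using fe eD by blast
    show "\<Union>\<D> \<subseteq> range f"
    proof
      fix x assume "x \<in> \<Union>\<D>"
      then obtain C where C: "C \<in> \<D>" "x \<in> C" by blast
      then obtain k where k: "e k = C" using e by (auto simp: bij_betw_def)
      obtain i where i: "i < m" "x = g C i" using bij[OF C(1)] C(2) by (auto simp: bij_betw_def)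
      have "f (k * m + i) = x" using i k m by (simp add: f_def)
      then show "x \<in> range f" by blast
    qed
  qed
  \<comment> \<open>Numbers at distance at least \<open>m\<close> lie in different blocks, so both
    sides of the lengthening conditions are false.\<close>
  have div: "i div m \<noteq> j div m" "j div m \<noteq> i div m" if "i + m \<le> j" for i j
  proof -
    have "Suc (i div m) \<le> j div m" using div_le_mono[OF that, of m] m by simp
    then show "i div m \<noteq> j div m" "j div m \<noteq> i div m" by simp_all
  qed
  have "nat_presentation m UNIV f (\<Union>\<D>) (E \<inter> \<Union>\<D> \<times> \<Union>\<D>)"
    unfolding nat_presentation_def
  proof (intro conjI)
    show "periodic_rel m {(i, j). i \<in> UNIV \<and> j \<in> UNIV \<and> f i = f j}"
      using m by (auto simp: f_eq periodic_rel_def)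
    have "{(i, j). i \<in> UNIV \<and> j \<in> UNIV \<and> (f i, f j) \<in> E \<inter> \<Union>\<D> \<times> \<Union>\<D>} =
        {(i, j). i div m = j div m \<and> (i mod m, j mod m) \<in> T}"
      using img f_edge by auto
    moreover have "periodic_rel m {(i, j). i div m = j div m \<and> (i mod m, j mod m) \<in> T}"
      unfolding periodic_rel_def using m div[of _ "_ + m"] div by auto
    ultimately show
      "periodic_rel m {(i, j). i \<in> UNIV \<and> j \<in> UNIV \<and> (f i, f j) \<in> E \<inter> \<Union>\<D> \<times> \<Union>\<D>}"
      by simp
  qed (use m img in \<open>simp_all add: periodic_set_def\<close>)
  then show ?thesis unfolding unary_FA_presentable_iff by blast
qed

lemma presentable_bounded_components:
  assumes V: "countable V" and EV: "E \<subseteq> V \<times> V"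
    and \<D>: "\<D> \<subseteq> components V E" and fin: "\<And>C. C \<in> \<D> \<Longrightarrow> finite C \<and> card C \<le> b"
  shows "unary_FA_presentable (\<Union>\<D>) (E \<inter> \<Union>\<D> \<times> \<Union>\<D>)"
proof -
  have "\<exists>g. bij_betw g {..<card C} C" if "C \<in> \<D>" for C
    using ex_bij_betw_nat_finite[of C] fin[OF that] by (simp add: lessThan_atLeast0)
  then obtain g where g: "\<And>C. C \<in> \<D> \<Longrightarrow> bij_betw (g C) {..<card C} C" by metis
  \<comment> \<open>The type depends on the chosen numbering \<open>g C\<close>, so isomorphic
    components may differ in type. It suffices that equal types give copies of one graph on
    \<open>{..<m}\<close> and that the bound \<open>b\<close> leaves finitely many types.\<close>
  define type where
    "type C = (card C, {(i, j). i < card C \<and> j < card C \<and> (g C i, g C j) \<in> E})" for C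
  define A where "A \<tau> = \<Union>{C \<in> \<D>. type C = \<tau>}" for \<tau>
  have "countable \<D>"
    using V \<D> by (auto simp: components_def intro: countable_subset)
  have disj: "C \<inter> D = {}" if "C \<in> \<D>" "D \<in> \<D>" "C \<noteq> D" for C D
    using components_disjoint that \<D> by (metis subsetD)
  have closed: "edge_closed E C" if "C \<in> \<D>" for C
    using edge_closed_component[OF EV] that \<D> by blast
  have "type ` \<D> \<subseteq> {..b} \<times> Pow ({..<b} \<times> {..<b})"
    using fin by (fastforce simp: type_def)
  then have "finite (type ` \<D>)" by (rule finite_subset) simp
  then have "unary_FA_presentable (\<Union>\<tau>\<in>type ` \<D>. A \<tau>)
      (E \<inter> (\<Union>\<tau>\<in>type ` \<D>. A \<tau>) \<times> (\<Union>\<tau>\<in>type ` \<D>. A \<tau>))"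
  proof (rule presentable_UN)
    fix \<tau> :: "nat \<times> (nat \<times> nat) set"
    obtain m T where \<tau>: "\<tau> = (m, T)" by (cases \<tau>)
    show "unary_FA_presentable (A \<tau>) (E \<inter> A \<tau> \<times> A \<tau>)"
      unfolding A_def
    proof (rule presentable_copies[where g = g and m = m and T = T])
      show "countable {C \<in> \<D>. type C = \<tau>}"
        using \<open>countable \<D>\<close> by (rule countable_subset[rotated]) auto
    qed (use g closed disj in \<open>auto simp: \<tau> type_def\<close>)
    show "edge_closed E (A \<tau>)"
      unfolding A_def using edge_closed_UN[of "{C \<in> \<D>. type C = \<tau>}" E id] closed by simp
  next
    fix \<tau> \<sigma> :: "nat \<times> (nat \<times> nat) set" assume "\<tau> \<noteq> \<sigma>"
    then show "A \<tau> \<inter> A \<sigma> = {}" unfolding A_def using disj by fastforce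
  qed
  moreover have "(\<Union>\<tau>\<in>type ` \<D>. A \<tau>) = \<Union>\<D>" by (auto simp: A_def)
  ultimately show ?thesis by simp
qed

section \<open>Splitting a directed forest into its infinite and its finite components\<close>

theorem theorem6p12:
  fixes V :: "'v set" and E :: "('v \<times> 'v) set"
  assumes "countable V" and "directed_forest V E"
  shows "unary_FA_presentable V E \<longleftrightarrow>
    (finite {C \<in> components V E. infinite C} \<and>
     (\<forall>C \<in> components V E. infinite C \<longrightarrow>
        directed_tree C (E \<inter> C \<times> C) \<and> unary_FA_presentable C (E \<inter> C \<times> C)) \<and>
     (\<exists>b::nat. \<forall>C \<in> components V E. finite C \<longrightarrow> card C \<le> b))"
    (is "_ \<longleftrightarrow> ?rhs")
proof
  have EV: "E \<subseteq> V \<times> V" using assms(2) by (simp add: directed_forest_def)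
  show ?rhs if "unary_FA_presentable V E"
    using presentable_components[OF that EV] directed_tree_component[OF assms(2)] by blast
  show "unary_FA_presentable V E" if rhs: ?rhs
  proof -
    let ?I = "{C \<in> components V E. infinite C}" and ?F = "{C \<in> components V E. finite C}"
    define U where "U = (\<Union>C\<in>?I. C)"
    define W where "W = \<Union>?F"
    obtain b where b: "\<And>C. C \<in> ?F \<Longrightarrow> card C \<le> b" using rhs by blast
    have "unary_FA_presentable U (E \<inter> U \<times> U)"
      unfolding U_def
    proof (rule presentable_UN)
      show "C \<inter> D = {}" if "C \<in> ?I" "D \<in> ?I" "C \<noteq> D" for C D
        using that components_disjoint[of C V E D] by simp
    qed (use rhs edge_closed_component[OF EV] in simp_all)
    moreover have "unary_FA_presentable W (E \<inter> W \<times> W)"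
      unfolding W_def
    proof (rule presentable_bounded_components[OF assms(1) EV])
      show "finite C \<and> card C \<le> b" if "C \<in> ?F" for C using b[OF that] that by simp
    qed simp
    moreover have disj: "U \<inter> W = {}"
    proof -
      have "C \<inter> D = {}" if "C \<in> ?I" "D \<in> ?F" for C D
        using that components_disjoint[of C V E D] by auto
      then show ?thesis unfolding U_def W_def by blast
    qed
    ultimately have "unary_FA_presentable (U \<union> W) (E \<inter> U \<times> U \<union> E \<inter> W \<times> W)"
      by (intro presentable_Un) auto
    moreover have V: "U \<union> W = V"
      using Union_components[of V E] unfolding U_def W_def by blast
    \<comment> \<open>No edge leaves \<open>U\<close>, and \<open>W\<close> is the rest of
      \<open>V\<close>, so no edge joins the two parts and the edge set splits.\<close>
    moreover have "edge_closed E U"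
      unfolding U_def by (intro edge_closed_UN edge_closed_component[OF EV]) simp
    then have "E \<inter> U \<times> U \<union> E \<inter> W \<times> W = E"
      using EV V disj unfolding edge_closed_def by blast
    ultimately show ?thesis by simp
  qed
qed

end
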